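(* Let $(M,g)$ be a compact connected $(m+d)$-dimensional Riemannian manifold with a rank-$m$ subbundle $H\subset TM$, let $(N,h)$ be a Riemannian manifold, let $G:N\to\mathbb{R}$ be a smooth function, and let $f:M\to N$ be a subelliptic harmonic map with potential $G$. If $N$ has nonpositive (sectional) curvature and the Hessian of $G$ is nonpositive definite (i.e. $\widetilde\nabla^2G\le 0$), then $f$ is stable.
   Context: Manifolds are without boundary. $H^\perp$ denotes the $g$-orthogonal complement of $H$ in $TM$, and $\pi_H:TM\to H$ is the orthogonal projection. $\widetilde\nabla$ is the Levi-Civita connection of $(N,h)$ and also denotes the pull-back connection on $f^{-1}TN$; $\widetilde R(X,Y)Z=\widetilde\nabla_X\widetilde\nabla_YZ-\widetilde\nabla_Y\widetilde\nabla_XZ-\widetilde\nabla_{[X,Y]}Z$ is the curvature tensor of $(N,h)$; $\widetilde\nabla^2G$ is the Hessian of $G$. $\{e_i\}_{i=1}^m$ is any local $g$-orthonormal frame of $H$, and $dv_g$ is the Riemannian volume element of $g$. The horizontal energy with potential $G$ of a smooth map $f:M\to N$ is $E(f)=\int_M[e_H(f)-G(f)]\,dv_g$, where $e_H(f)=\frac12|df\circ\pi_H|^2=\frac12\sum_{i=1}^m\langle df(e_i),df(e_i)\rangle$. A smooth map $f$ is a subelliptic harmonic map with potential $G$ if it is a critical map of $E$, i.e. $\frac{d}{dt}E(f_t)|_{t=0}=0$ for every smooth variation $\{f_t\}_{|t|<\epsilon}$ of $f$ with $f_0=f$. For such $f$ and $V\in\Gamma(f^{-1}TN)$, set $$I_{HG}(V,V)=\int_M\Big\{\sum_{i=1}^m\big[\langle\widetilde\nabla_{e_i}V,\widetilde\nabla_{e_i}V\rangle-\langle\widetilde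 R(df(e_i),V)V,df(e_i)\rangle\big]-\widetilde\nabla^2G(f)(V,V)\Big\}dv_g.$$ The map $f$ is called stable if $I_{HG}(V,V)\ge 0$ for every $V\in\Gamma(f^{-1}TN)$. *)

theory Defs
  imports "HOL-Analysis.Analysis"
begin

section \<open>Smooth functions on open subsets of normed spaces\<close>

text \<open>To be used for open \<open>S\<close> in a finite-dimensional space, where this is the usual notion of \<open>C^k\<close>.\<close>

primrec Ck_on ::
  "nat \<Rightarrow> 'v::real_normed_vector set \<Rightarrow> ('v \<Rightarrow> 'w::real_normed_vector) \<Rightarrow> bool" where
  "Ck_on 0 S f \<longleftrightarrow> continuous_on S f"
| "Ck_on (Suc k) S f \<longleftrightarrow>
     (\<forall>x\<in>S. f differentiable (at x)) \<and>
     (\<forall>v. Ck_on k S (\<lambda>x. frechet_derivative f (at x) v))"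

definition smooth_on ::
  "'v::real_normed_vector set \<Rightarrow> ('v \<Rightarrow> 'w::real_normed_vector) \<Rightarrow> bool" where
  "smooth_on S f \<longleftrightarrow> (\<forall>k. Ck_on k S f)"


section \<open>Smooth manifolds\<close>

text \<open>
  A manifold without boundary is a Hausdorff, second countable type together with a smooth atlas.
  A chart is a pair of an open domain and a coordinate map with open image in the model space.
\<close>

type_synonym ('a, 'e) chart = "'a set \<times> ('a \<Rightarrow> 'e)"
type_synonym ('a, 'e) atlas = "('a, 'e) chart set"

definition chart_inv :: "('a, 'e) chart \<Rightarrow> 'e \<Rightarrow> 'a" where
  "chart_inv c = inv_into (fst c) (snd c)"

definition smooth_atlas ::
  "('a::{t2_space,second_countable_topology}, 'e::euclidean_space) atlas \<Rightarrow> bool" where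
  "smooth_atlas A \<longleftrightarrow>
     (\<Union>c\<in>A. fst c) = UNIV \<and>
     (\<forall>c\<in>A. open (fst c) \<and> open (snd c ` fst c) \<and>
        homeomorphism (fst c) (snd c ` fst c) (snd c) (chart_inv c)) \<and>
     (\<forall>c\<in>A. \<forall>c'\<in>A. smooth_on (snd c ` (fst c \<inter> fst c')) (snd c' \<circ> chart_inv c))"

text \<open>
  Smoothness on an open set \<open>U\<close> of a function with values in a normed space,
  and of a map into another manifold.
\<close>

definition smooth_fun ::
  "('a, 'e::euclidean_space) atlas \<Rightarrow> 'a set \<Rightarrow> ('a \<Rightarrow> 'w::real_normed_vector) \<Rightarrow> bool" where
  "smooth_fun A U u \<longleftrightarrow> (\<forall>c\<in>A. smooth_on (snd c ` (fst c \<inter> U)) (u \<circ> chart_inv c))"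

definition smooth_map ::
  "('a::topological_space, 'e::euclidean_space) atlas \<Rightarrow> 'a set \<Rightarrow>
   ('b::topological_space, 'k::euclidean_space) atlas \<Rightarrow> ('a \<Rightarrow> 'b) \<Rightarrow> bool" where
  "smooth_map A U B f \<longleftrightarrow>
     continuous_on U f \<and> (\<forall>c'\<in>B. smooth_fun A (U \<inter> f -` fst c') (snd c' \<circ> f))"

text \<open>The product manifold of the real line with a manifold.\<close>

definition line_product_atlas :: "('a, 'e) atlas \<Rightarrow> (real \<times> 'a, real \<times> 'e) atlas" where
  "line_product_atlas A = (\<lambda>c. (UNIV \<times> fst c, \<lambda>(t, p). (t, snd c p))) ` A"


section \<open>Tangent vectors\<close>

text \<open>
  Every point \<open>p\<close> has a preferred chart, and the tangent space at \<open>p\<close> is identified with the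
  whole model space by taking coordinates in that chart.  Vector fields are therefore functions
  \<open>'a \<Rightarrow> 'e\<close>, but the value at each point refers to the preferred chart of that point; only the
  components \<open>tcoord A c q (X q)\<close> in a fixed chart \<open>c\<close> can be expected to depend smoothly on \<open>q\<close>.
\<close>

definition chart_at :: "('a, 'e) atlas \<Rightarrow> 'a \<Rightarrow> ('a, 'e) chart" where
  "chart_at A p = (SOME c. c \<in> A \<and> p \<in> fst c)"

text \<open>The derivative of \<open>u\<close> at \<open>p\<close> in the direction of the tangent vector \<open>x\<close>.\<close>

definition dir_deriv ::
  "('a, 'e::euclidean_space) atlas \<Rightarrow> ('a \<Rightarrow> 'w::real_normed_vector) \<Rightarrow> 'a \<Rightarrow> 'e \<Rightarrow> 'w" where
  "dir_deriv A u p x =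
     frechet_derivative (u \<circ> chart_inv (chart_at A p)) (at (snd (chart_at A p) p)) x"

text \<open>
  \<open>tcoord A c q v\<close> are the components of \<open>v\<close> in the chart \<open>c\<close>; conversely \<open>tvec A c q a\<close> is the
  tangent vector at \<open>q\<close> whose components in the chart \<open>c\<close> are \<open>a\<close>.
\<close>

definition tcoord ::
  "('a, 'e::euclidean_space) atlas \<Rightarrow> ('a, 'e) chart \<Rightarrow> 'a \<Rightarrow> 'e \<Rightarrow> 'e" where
  "tcoord A c q v = dir_deriv A (snd c) q v"

definition tvec ::
  "('a, 'e::euclidean_space) atlas \<Rightarrow> ('a, 'e) chart \<Rightarrow> 'a \<Rightarrow> 'e \<Rightarrow> 'e" where
  "tvec A c q a = frechet_derivative (snd (chart_at A q) \<circ> chart_inv c) (at (snd c q)) a"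

text \<open>The vector field on the domain of \<open>c\<close> with constant components \<open>a\<close>.\<close>

definition coord_field ::
  "('a, 'e::euclidean_space) atlas \<Rightarrow> ('a, 'e) chart \<Rightarrow> 'e \<Rightarrow> 'a \<Rightarrow> 'e" where
  "coord_field A c a q = (if q \<in> fst c then tvec A c q a else 0)"

definition differential ::
  "('a, 'e::euclidean_space) atlas \<Rightarrow> ('b, 'k::euclidean_space) atlas \<Rightarrow> ('a \<Rightarrow> 'b) \<Rightarrow>
   'a \<Rightarrow> 'e \<Rightarrow> 'k" where
  "differential A B f p x = dir_deriv A (snd (chart_at B (f p)) \<circ> f) p x"

definition smooth_field ::
  "('a, 'e::euclidean_space) atlas \<Rightarrow> 'a set \<Rightarrow> ('a \<Rightarrow> 'e) \<Rightarrow> bool" where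
  "smooth_field A U X \<longleftrightarrow> (\<forall>c\<in>A. smooth_fun A (U \<inter> fst c) (\<lambda>q. tcoord A c q (X q)))"

text \<open>Smooth sections of the pull-back bundle of the tangent bundle along \<open>f\<close>.\<close>

definition smooth_section ::
  "('a, 'e::euclidean_space) atlas \<Rightarrow> ('b, 'k::euclidean_space) atlas \<Rightarrow> ('a \<Rightarrow> 'b) \<Rightarrow>
   ('a \<Rightarrow> 'k) \<Rightarrow> bool" where
  "smooth_section A B f V \<longleftrightarrow>
     (\<forall>c'\<in>B. smooth_fun A (f -` fst c') (\<lambda>p. tcoord B c' (f p) (V p)))"

definition lie_bracket ::
  "('a, 'e::euclidean_space) atlas \<Rightarrow> ('a \<Rightarrow> 'e) \<Rightarrow> ('a \<Rightarrow> 'e) \<Rightarrow> 'a \<Rightarrow> 'e" where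
  "lie_bracket A X Y p =
     dir_deriv A (\<lambda>q. tcoord A (chart_at A p) q (Y q)) p (X p) -
     dir_deriv A (\<lambda>q. tcoord A (chart_at A p) q (X q)) p (Y p)"

definition subbundle ::
  "('a::topological_space, 'e::euclidean_space) atlas \<Rightarrow> nat \<Rightarrow> ('a \<Rightarrow> 'e set) \<Rightarrow> bool" where
  "subbundle A m H \<longleftrightarrow>
     (\<forall>p. subspace (H p) \<and> dim (H p) = m) \<and>
     (\<forall>p. \<exists>U X. open U \<and> p \<in> U \<and> (\<forall>i<m. smooth_field A U (X i)) \<and>
        (\<forall>q\<in>U. span ((\<lambda>i::nat. X i q) ` {..<m}) = H q))"


section \<open>Riemannian metrics\<close>

definition riemannian_metric ::
  "('a, 'e::euclidean_space) atlas \<Rightarrow> ('a \<Rightarrow> 'e \<Rightarrow> 'e \<Rightarrow> real) \<Rightarrow> bool" where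
  "riemannian_metric A g \<longleftrightarrow>
     (\<forall>p. bilinear (g p) \<and> (\<forall>x y. g p x y = g p y x) \<and> (\<forall>x. x \<noteq> 0 \<longrightarrow> g p x x > 0)) \<and>
     (\<forall>c\<in>A. \<forall>a b. smooth_fun A (fst c) (\<lambda>p. g p (tvec A c p a) (tvec A c p b)))"

definition volume_density ::
  "('a, real^'n) atlas \<Rightarrow> ('a \<Rightarrow> real^'n \<Rightarrow> real^'n \<Rightarrow> real) \<Rightarrow>
   ('a, real^'n) chart \<Rightarrow> real^'n \<Rightarrow> real" where
  "volume_density A g c u =
     (let p = chart_inv c u in
      sqrt (det (\<chi> i j. g p (tvec A c p (axis i 1)) (tvec A c p (axis j 1)))))"

text \<open>
  The volume measure is determined by its values on Borel subsets of chart domains,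
  since countably many chart domains cover the manifold.
\<close>

definition riemannian_volume ::
  "('a::topological_space, real^'n) atlas \<Rightarrow> ('a \<Rightarrow> real^'n \<Rightarrow> real^'n \<Rightarrow> real) \<Rightarrow>
   'a measure" where
  "riemannian_volume A g =
     (THE \<mu>. sets \<mu> = sets borel \<and>
        (\<forall>c\<in>A. \<forall>S\<in>sets borel. S \<subseteq> fst c \<longrightarrow>
           emeasure \<mu> S = (\<integral>\<^sup>+u\<in>snd c ` S. ennreal (volume_density A g c u) \<partial>lborel)))"


section \<open>The Levi-Civita connection\<close>

text \<open>
  \<open>nabla p x Y\<close> is the covariant derivative at \<open>p\<close>, in the direction of the tangent vector \<open>x\<close>,
  of a vector field \<open>Y\<close> that is smooth near \<open>p\<close>; for other \<open>Y\<close> its value is irrelevant.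
  On such fields the Levi-Civita connection exists and is unique.
\<close>

type_synonym ('b, 'k) connection = "'b \<Rightarrow> 'k \<Rightarrow> ('b \<Rightarrow> 'k) \<Rightarrow> 'k"

definition affine_connection ::
  "('b::topological_space, 'k::euclidean_space) atlas \<Rightarrow> ('b, 'k) connection \<Rightarrow> bool" where
  "affine_connection B nabla \<longleftrightarrow>
     (\<forall>U Y. open U \<and> smooth_field B U Y \<longrightarrow>
        (\<forall>p\<in>U. linear (\<lambda>x. nabla p x Y)) \<and>
        (\<forall>Z. (\<forall>q\<in>U. Z q = Y q) \<longrightarrow> (\<forall>p\<in>U. \<forall>x. nabla p x Z = nabla p x Y)) \<and>
        (\<forall>Z. smooth_field B U Z \<longrightarrow>
           (\<forall>p\<in>U. \<forall>x. nabla p x (\<lambda>q. Y q + Z q) = nabla p x Y + nabla p x Z)) \<and>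
        (\<forall>u::'b \<Rightarrow> real. smooth_fun B U u \<longrightarrow>
           (\<forall>p\<in>U. \<forall>x. nabla p x (\<lambda>q. u q *\<^sub>R Y q) =
              dir_deriv B u p x *\<^sub>R Y p + u p *\<^sub>R nabla p x Y)) \<and>
        (\<forall>X. smooth_field B U X \<longrightarrow> smooth_field B U (\<lambda>q. nabla q (X q) Y)))"

definition levi_civita ::
  "('b::topological_space, 'k::euclidean_space) atlas \<Rightarrow> ('b \<Rightarrow> 'k \<Rightarrow> 'k \<Rightarrow> real) \<Rightarrow>
   ('b, 'k) connection \<Rightarrow> bool" where
  "levi_civita B h nabla \<longleftrightarrow>
     affine_connection B nabla \<and>
     (\<forall>U X Y. open U \<and> smooth_field B U X \<and> smooth_field B U Y \<longrightarrow>
        (\<forall>p\<in>U. nabla p (X p) Y - nabla p (Y p) X = lie_bracket B X Y p) \<and>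
        (\<forall>p\<in>U. \<forall>z. dir_deriv B (\<lambda>q. h q (X q) (Y q)) p z =
           h p (nabla p z X) (Y p) + h p (X p) (nabla p z Y)))"

definition curvature ::
  "('b, 'k::euclidean_space) atlas \<Rightarrow> ('b, 'k) connection \<Rightarrow>
   ('b \<Rightarrow> 'k) \<Rightarrow> ('b \<Rightarrow> 'k) \<Rightarrow> ('b \<Rightarrow> 'k) \<Rightarrow> 'b \<Rightarrow> 'k" where
  "curvature B nabla X Y Z p =
     nabla p (X p) (\<lambda>q. nabla q (Y q) Z) - nabla p (Y p) (\<lambda>q. nabla q (X q) Z) -
     nabla p (lie_bracket B X Y p) Z"

text \<open>
  The curvature and the Hessian are tensorial, so their values on tangent vectors at \<open>p\<close> may be
  computed by extending the vectors to fields with constant components in the preferred chart.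
\<close>

definition extend_vec ::
  "('b, 'k::euclidean_space) atlas \<Rightarrow> 'b \<Rightarrow> 'k \<Rightarrow> 'b \<Rightarrow> 'k" where
  "extend_vec B p x = coord_field B (chart_at B p) x"

definition curvature_tensor ::
  "('b, 'k::euclidean_space) atlas \<Rightarrow> ('b, 'k) connection \<Rightarrow> 'b \<Rightarrow> 'k \<Rightarrow> 'k \<Rightarrow> 'k \<Rightarrow> 'k" where
  "curvature_tensor B nabla p x y z =
     curvature B nabla (extend_vec B p x) (extend_vec B p y) (extend_vec B p z) p"

definition sectional_curvature ::
  "('b, 'k::euclidean_space) atlas \<Rightarrow> ('b \<Rightarrow> 'k \<Rightarrow> 'k \<Rightarrow> real) \<Rightarrow> ('b, 'k) connection \<Rightarrow>
   'b \<Rightarrow> 'k \<Rightarrow> 'k \<Rightarrow> real" where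
  "sectional_curvature B h nabla p x y =
     h p (curvature_tensor B nabla p x y y) x / (h p x x * h p y y - (h p x y)\<^sup>2)"

definition nonpositive_sectional_curvature ::
  "('b, 'k::euclidean_space) atlas \<Rightarrow> ('b \<Rightarrow> 'k \<Rightarrow> 'k \<Rightarrow> real) \<Rightarrow> ('b, 'k) connection \<Rightarrow>
   bool" where
  "nonpositive_sectional_curvature B h nabla \<longleftrightarrow>
     (\<forall>p x y. x \<noteq> y \<and> independent {x, y} \<longrightarrow> sectional_curvature B h nabla p x y \<le> 0)"

definition hessian ::
  "('b, 'k::euclidean_space) atlas \<Rightarrow> ('b, 'k) connection \<Rightarrow> ('b \<Rightarrow> real) \<Rightarrow>
   'b \<Rightarrow> 'k \<Rightarrow> 'k \<Rightarrow> real" where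
  "hessian B nabla G p x y =
     dir_deriv B (\<lambda>q. dir_deriv B G q (extend_vec B p y q)) p x -
     dir_deriv B G p (nabla p x (extend_vec B p y))"

text \<open>
  The pull-back connection.  Near \<open>p\<close> a section \<open>V\<close> along \<open>f\<close> is a combination
  \<open>\<Sum>b. V\<^sup>b *\<^sub>R (\<partial>\<^sub>b \<circ> f)\<close> of the coordinate fields of the preferred chart at \<open>f p\<close>, and the formula
  follows from the Leibniz rule and the defining property that the derivative of \<open>W \<circ> f\<close> along
  \<open>x\<close> is the derivative of \<open>W\<close> along \<open>df x\<close>.
\<close>

definition pullback_connection ::
  "('a, 'e::euclidean_space) atlas \<Rightarrow> ('b, 'k::euclidean_space) atlas \<Rightarrow> ('b, 'k) connection \<Rightarrow>
   ('a \<Rightarrow> 'b) \<Rightarrow> 'a \<Rightarrow> 'e \<Rightarrow> ('a \<Rightarrow> 'k) \<Rightarrow> 'k" where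
  "pullback_connection A B nabla f p x V =
     (let c = chart_at B (f p) in
      dir_deriv A (\<lambda>q. tcoord B c (f q) (V q)) p x +
      (\<Sum>b\<in>Basis. (V p \<bullet> b) *\<^sub>R nabla (f p) (differential A B f p x) (coord_field B c b)))"


section \<open>Subelliptic harmonic maps with potential\<close>

text \<open>
  The expressions below are independent of the orthonormal frame and involve only its values at
  the point in question, so an orthonormal basis of each \<open>H p\<close> is chosen separately.
\<close>

definition horizontal_frame ::
  "('a \<Rightarrow> 'e::euclidean_space \<Rightarrow> 'e \<Rightarrow> real) \<Rightarrow> nat \<Rightarrow> ('a \<Rightarrow> 'e set) \<Rightarrow> 'a \<Rightarrow> nat \<Rightarrow> 'e" where
  "horizontal_frame g m H p =
     (SOME e. (\<forall>i<m. \<forall>j<m. g p (e i) (e j) = (if i = j then 1 else 0)) \<and>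
        span (e ` {..<m}) = H p)"

definition horizontal_energy_density ::
  "('a, real^'n) atlas \<Rightarrow> ('a \<Rightarrow> real^'n \<Rightarrow> real^'n \<Rightarrow> real) \<Rightarrow> nat \<Rightarrow> ('a \<Rightarrow> (real^'n) set) \<Rightarrow>
   ('b, 'k::euclidean_space) atlas \<Rightarrow> ('b \<Rightarrow> 'k \<Rightarrow> 'k \<Rightarrow> real) \<Rightarrow> ('a \<Rightarrow> 'b) \<Rightarrow> 'a \<Rightarrow> real" where
  "horizontal_energy_density A g m H B h f p =
     (1 / 2) * (\<Sum>i<m. h (f p) (differential A B f p (horizontal_frame g m H p i))
                              (differential A B f p (horizontal_frame g m H p i)))"

definition horizontal_energy ::
  "('a::topological_space, real^'n) atlas \<Rightarrow> ('a \<Rightarrow> real^'n \<Rightarrow> real^'n \<Rightarrow> real) \<Rightarrow> nat \<Rightarrow>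
   ('a \<Rightarrow> (real^'n) set) \<Rightarrow> ('b, 'k::euclidean_space) atlas \<Rightarrow> ('b \<Rightarrow> 'k \<Rightarrow> 'k \<Rightarrow> real) \<Rightarrow>
   ('b \<Rightarrow> real) \<Rightarrow> ('a \<Rightarrow> 'b) \<Rightarrow> real" where
  "horizontal_energy A g m H B h G f =
     (\<integral>p. (horizontal_energy_density A g m H B h f p - G (f p)) \<partial>riemannian_volume A g)"

definition smooth_variation ::
  "('a::topological_space, 'e::euclidean_space) atlas \<Rightarrow>
   ('b::topological_space, 'k::euclidean_space) atlas \<Rightarrow> ('a \<Rightarrow> 'b) \<Rightarrow> real \<Rightarrow>
   (real \<Rightarrow> 'a \<Rightarrow> 'b) \<Rightarrow> bool" where
  "smooth_variation A B f \<epsilon> F \<longleftrightarrow>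
     \<epsilon> > 0 \<and> F 0 = f \<and>
     smooth_map (line_product_atlas A) ({-\<epsilon><..<\<epsilon>} \<times> UNIV) B (\<lambda>(t, p). F t p)"

definition subelliptic_harmonic ::
  "('a::topological_space, real^'n) atlas \<Rightarrow> ('a \<Rightarrow> real^'n \<Rightarrow> real^'n \<Rightarrow> real) \<Rightarrow> nat \<Rightarrow>
   ('a \<Rightarrow> (real^'n) set) \<Rightarrow> ('b::topological_space, 'k::euclidean_space) atlas \<Rightarrow>
   ('b \<Rightarrow> 'k \<Rightarrow> 'k \<Rightarrow> real) \<Rightarrow> ('b \<Rightarrow> real) \<Rightarrow> ('a \<Rightarrow> 'b) \<Rightarrow> bool" where
  "subelliptic_harmonic A g m H B h G f \<longleftrightarrow>
     smooth_map A UNIV B f \<and>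
     (\<forall>\<epsilon> F. smooth_variation A B f \<epsilon> F \<longrightarrow>
        ((\<lambda>t. horizontal_energy A g m H B h G (F t)) has_real_derivative 0) (at 0))"

definition index_form ::
  "('a::topological_space, real^'n) atlas \<Rightarrow> ('a \<Rightarrow> real^'n \<Rightarrow> real^'n \<Rightarrow> real) \<Rightarrow> nat \<Rightarrow>
   ('a \<Rightarrow> (real^'n) set) \<Rightarrow> ('b, 'k::euclidean_space) atlas \<Rightarrow> ('b \<Rightarrow> 'k \<Rightarrow> 'k \<Rightarrow> real) \<Rightarrow>
   ('b, 'k) connection \<Rightarrow> ('b \<Rightarrow> real) \<Rightarrow> ('a \<Rightarrow> 'b) \<Rightarrow> ('a \<Rightarrow> 'k) \<Rightarrow> real" where
  "index_form A g m H B h nabla G f V =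
     (\<integral>p. ((\<Sum>i<m. let e = horizontal_frame g m H p i;
                        D = pullback_connection A B nabla f p e V;
                        w = differential A B f p e
                    in h (f p) D D - h (f p) (curvature_tensor B nabla (f p) w (V p) (V p)) w) -
           hessian B nabla G (f p) (V p) (V p)) \<partial>riemannian_volume A g)"

definition stable_map ::
  "('a::topological_space, real^'n) atlas \<Rightarrow> ('a \<Rightarrow> real^'n \<Rightarrow> real^'n \<Rightarrow> real) \<Rightarrow> nat \<Rightarrow>
   ('a \<Rightarrow> (real^'n) set) \<Rightarrow> ('b, 'k::euclidean_space) atlas \<Rightarrow> ('b \<Rightarrow> 'k \<Rightarrow> 'k \<Rightarrow> real) \<Rightarrow>
   ('b, 'k) connection \<Rightarrow> ('b \<Rightarrow> real) \<Rightarrow> ('a \<Rightarrow> 'b) \<Rightarrow> bool" where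
  "stable_map A g m H B h nabla G f \<longleftrightarrow>
     (\<forall>V. smooth_section A B f V \<longrightarrow> index_form A g m H B h nabla G f V \<ge> 0)"

end

theory Submission
  imports Defs
begin

text \<open>
  The integrand of \<open>I\<^sub>H\<^sub>G(V,V)\<close> is nonnegative at every point: \<open>\<langle>R(w,v)v,w\<rangle>\<close> is the sectional
  curvature times the positive Gram determinant if \<open>w\<close> and \<open>v\<close> are independent, and it vanishes
  otherwise because \<open>R\<close> is alternating and linear in its first two arguments.  Since the curvature
  tensor is computed from coordinate fields, the latter needs these fields to be smooth and to commute.
\<close>

section \<open>Calculus of \<open>C\<^sup>k\<close> functions\<close>

lemma Ck_on_subset: "Ck_on k S f \<Longrightarrow> T \<subseteq> S \<Longrightarrow> Ck_on k T f"
  by (induction k arbitrary: f) (auto intro: continuous_on_subset)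

text \<open>\<open>frechet_derivative\<close> is a choice from the maps satisfying
  \<open>has_derivative\<close>. Functions agreeing near \<open>x\<close> satisfy this for the same
  maps, so the choices coincide even at points of nondifferentiability.\<close>

lemma frechet_derivative_cong_open:
  assumes "open S" "x \<in> S" "\<And>y. y \<in> S \<Longrightarrow> f y = g y"
  shows "frechet_derivative f (at x) = frechet_derivative g (at x)"
proof -
  have "(f has_derivative D) (at x) \<longleftrightarrow> (g has_derivative D) (at x)" for D
    using assms has_derivative_transform_within_open[of _ _ x UNIV S] by metis
  then show ?thesis
    unfolding frechet_derivative_def by simp
qed

lemma differentiable_cong_open:
  assumes "f differentiable (at x)" "open S" "x \<in> S" "\<And>y. y \<in> S \<Longrightarrow> f y = g y"
  shows "g differentiable (at x)"
  using assms has_derivative_transform_within_open unfolding differentiable_def by metis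

text \<open>Openness of \<open>S\<close> makes the derivatives at points of \<open>S\<close> agree
  as well, so the induction passes to them. This is what allows an explicit formula, valid on
  \<open>S\<close> only, to replace \<open>frechet_derivative\<close> in the closure proofs
  below.\<close>

lemma Ck_on_cong:
  assumes "open S" "\<And>x. x \<in> S \<Longrightarrow> f x = g x" "Ck_on k S f"
  shows "Ck_on k S g"
  using assms(2,3)
proof (induction k arbitrary: f g)
  case 0
  then show ?case
    using continuous_on_cong by (metis Ck_on.simps(1))
next
  case (Suc k)
  have "Ck_on k S (\<lambda>x. frechet_derivative g (at x) v)" for v
  proof (rule Suc.IH)
    show "Ck_on k S (\<lambda>x. frechet_derivative f (at x) v)"
      using Suc.prems by simp
    show "frechet_derivative f (at x) v = frechet_derivative g (at x) v" if "x \<in> S" for x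
      using frechet_derivative_cong_open[OF assms(1) that] Suc.prems(1) by metis
  qed
  moreover have "g differentiable (at x)" if "x \<in> S" for x
    using differentiable_cong_open[OF _ assms(1) that] Suc.prems that by auto
  ultimately show ?case
    by simp
qed

text \<open>At the bottom level differentiability gives continuity; above it the claim passes to the
  directional derivatives. The product and chain rules need it because their formulas still contain
  undifferentiated factors.\<close>

lemma Ck_on_SucD: "Ck_on (Suc k) S f \<Longrightarrow> Ck_on k S f"
proof (induction k arbitrary: f)
  case 0
  then show ?case
    by (auto intro!: continuous_at_imp_continuous_on differentiable_imp_continuous_within)
next
  case (Suc k)
  have "Ck_on k S (\<lambda>x. frechet_derivative f (at x) v)" for v
    using Suc.prems by (intro Suc.IH) simp
  then show ?case
    using Suc.prems by auto
qed

section \<open>Closure of \<open>C^k\<close> functions under linear maps, sums, products and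
  composition\<close>

lemma Ck_on_const: "Ck_on k S (\<lambda>x. c)"
proof (induction k arbitrary: c)
  case (Suc k)
  have "frechet_derivative (\<lambda>x::'a. c) (at x) v = 0" for x v
    by (metis frechet_derivative_at has_derivative_const)
  with Suc[of 0] show ?case
    by simp
qed simp

lemma Ck_on_bounded_linear:
  assumes L: "bounded_linear L" and "open S"
  shows "Ck_on k S f \<Longrightarrow> Ck_on k S (\<lambda>x. L (f x))"
proof (induction k arbitrary: f)
  case 0
  then show ?case
    using L bounded_linear.continuous_on by auto
next
  case (Suc k)
  have D: "((\<lambda>x. L (f x)) has_derivative (\<lambda>v. L (frechet_derivative f (at x) v))) (at x)"
    if "x \<in> S" for x
    using Suc.prems that L
    by (auto intro!: bounded_linear.has_derivative[OF L] simp: frechet_derivative_works[symmetric])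
  have "Ck_on k S (\<lambda>x. frechet_derivative (\<lambda>x. L (f x)) (at x) v)" for v
  proof (rule Ck_on_cong[OF \<open>open S\<close>])
    show "Ck_on k S (\<lambda>x. L (frechet_derivative f (at x) v))"
      using Suc.prems by (intro Suc.IH) simp
    show "L (frechet_derivative f (at x) v) = frechet_derivative (\<lambda>x. L (f x)) (at x) v"
      if "x \<in> S" for x
      using frechet_derivative_at[OF D[OF that]] by metis
  qed
  then show ?case
    using D by (auto simp: differentiable_def)
qed

lemma Ck_on_add:
  assumes "open S"
  shows "Ck_on k S f \<Longrightarrow> Ck_on k S g \<Longrightarrow> Ck_on k S (\<lambda>x. f x + g x)"
proof (induction k arbitrary: f g)
  case 0
  then show ?case
    by (simp add: continuous_on_add continuous_on_scaleR)
next
  case (Suc k)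
  have D: "((\<lambda>x. f x + g x) has_derivative
      (\<lambda>v. frechet_derivative f (at x) v + frechet_derivative g (at x) v)) (at x)" if "x \<in> S" for x
    using Suc.prems that by (auto intro!: has_derivative_add simp: frechet_derivative_works[symmetric])
  have "Ck_on k S (\<lambda>x. frechet_derivative (\<lambda>x. f x + g x) (at x) v)" for v
  proof (rule Ck_on_cong[OF \<open>open S\<close>])
    show "Ck_on k S (\<lambda>x. frechet_derivative f (at x) v + frechet_derivative g (at x) v)"
      using Suc.prems by (intro Suc.IH) simp_all
    show "frechet_derivative f (at x) v + frechet_derivative g (at x) v =
        frechet_derivative (\<lambda>x. f x + g x) (at x) v" if "x \<in> S" for x
      using frechet_derivative_at[OF D[OF that]] by metis
  qed
  then show ?case
    using D by (auto simp: differentiable_def)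
qed

lemma Ck_on_sum:
  assumes "open S" "\<And>i. i \<in> I \<Longrightarrow> Ck_on k S (f i)"
  shows "Ck_on k S (\<lambda>x. \<Sum>i\<in>I. f i x)"
  using assms(2)
  by (induction I rule: infinite_finite_induct) (auto intro: Ck_on_const Ck_on_add[OF assms(1)])

text \<open>Induction through the Leibniz rule: each of its two terms is a product of one factor and
  a derivative of the other, both of class \<open>C^k\<close> once the undifferentiated factor is
  lowered by \<open>Ck_on_SucD\<close>.\<close>

lemma Ck_on_scaleR:
  fixes u :: "'v::real_normed_vector \<Rightarrow> real"
  assumes "open S"
  shows "Ck_on k S u \<Longrightarrow> Ck_on k S f \<Longrightarrow> Ck_on k S (\<lambda>x. u x *\<^sub>R f x)"
proof (induction k arbitrary: u f)
  case 0
  then show ?case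
    by (simp add: continuous_on_add continuous_on_scaleR)
next
  case (Suc k)
  have D: "((\<lambda>x. u x *\<^sub>R f x) has_derivative
      (\<lambda>v. u x *\<^sub>R frechet_derivative f (at x) v + frechet_derivative u (at x) v *\<^sub>R f x)) (at x)"
    if "x \<in> S" for x
    using Suc.prems that by (auto intro!: has_derivative_scaleR simp: frechet_derivative_works[symmetric])
  have "Ck_on k S (\<lambda>x. frechet_derivative (\<lambda>x. u x *\<^sub>R f x) (at x) v)" for v
  proof (rule Ck_on_cong[OF \<open>open S\<close>])
    show "Ck_on k S (\<lambda>x. u x *\<^sub>R frechet_derivative f (at x) v + frechet_derivative u (at x) v *\<^sub>R f x)"
      using Suc.prems Ck_on_SucD[OF Suc.prems(1)] Ck_on_SucD[OF Suc.prems(2)]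
      by (intro Ck_on_add[OF assms] Suc.IH) simp_all
    show "u x *\<^sub>R frechet_derivative f (at x) v + frechet_derivative u (at x) v *\<^sub>R f x =
        frechet_derivative (\<lambda>x. u x *\<^sub>R f x) (at x) v" if "x \<in> S" for x
      using frechet_derivative_at[OF D[OF that]] by metis
  qed
  then show ?case
    using D by (auto simp: differentiable_def)
qed

text \<open>By the chain rule the derivative of \<open>g\<close> is taken in the direction
  \<open>frechet_derivative f (at x) v\<close>, which varies with \<open>x\<close>, while
  \<open>Ck_on\<close> controls fixed directions only. Expanding this direction in the basis of the
  Euclidean space in the middle leaves products of scalar \<open>C^k\<close> functions with partial
  derivatives of \<open>g\<close> composed with \<open>f\<close>; the induction hypothesis, general
  in \<open>g\<close>, covers the latter.\<close>

lemma Ck_on_compose: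
  fixes f :: "'u::real_normed_vector \<Rightarrow> 'v::euclidean_space"
  assumes "open S"
  shows "Ck_on k S f \<Longrightarrow> Ck_on k T g \<Longrightarrow> f ` S \<subseteq> T \<Longrightarrow> Ck_on k S (g \<circ> f)"
proof (induction k arbitrary: g)
  case 0
  then show ?case
    using continuous_on_compose continuous_on_subset by (metis Ck_on.simps(1))
next
  case (Suc k)
  have D: "((g \<circ> f) has_derivative
      (frechet_derivative g (at (f x)) \<circ> frechet_derivative f (at x))) (at x)" if "x \<in> S" for x
    using Suc.prems that by (intro diff_chain_at) (auto simp: frechet_derivative_works[symmetric])
  have "Ck_on k S (\<lambda>x. frechet_derivative (g \<circ> f) (at x) v)" for v
  proof (rule Ck_on_cong[OF \<open>open S\<close>])
    show "Ck_on k S (\<lambda>x. \<Sum>b\<in>Basis. (frechet_derivative f (at x) v \<bullet> b) *\<^sub>R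
        ((\<lambda>y. frechet_derivative g (at y) b) \<circ> f) x)"
      using Suc.prems Ck_on_SucD[OF Suc.prems(1)]
      by (intro Ck_on_sum Ck_on_scaleR Ck_on_bounded_linear[OF bounded_linear_inner_left] Suc.IH assms) auto
    show "(\<Sum>b\<in>Basis. (frechet_derivative f (at x) v \<bullet> b) *\<^sub>R
        ((\<lambda>y. frechet_derivative g (at y) b) \<circ> f) x) = frechet_derivative (g \<circ> f) (at x) v"
      if "x \<in> S" for x
    proof -
      have lin: "linear (frechet_derivative g (at (f x)))"
        using Suc.prems that by (intro linear_frechet_derivative) auto
      have "frechet_derivative g (at (f x)) w =
          (\<Sum>b\<in>Basis. (w \<bullet> b) *\<^sub>R frechet_derivative g (at (f x)) b)" for w
        by (subst euclidean_representation[of w, symmetric])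
          (simp only: linear_sum[OF lin] linear_scale[OF lin])
      then show ?thesis
        unfolding frechet_derivative_at[OF D[OF that], symmetric] comp_apply by metis
    qed
  qed
  then show ?case
    using D unfolding Ck_on.simps differentiable_def by blast
qed

section \<open>The same rules for smooth functions\<close>

lemma smooth_on_compose:
  fixes f :: "'u::real_normed_vector \<Rightarrow> 'v::euclidean_space"
  shows "open S \<Longrightarrow> smooth_on S f \<Longrightarrow> smooth_on T g \<Longrightarrow> f ` S \<subseteq> T \<Longrightarrow> smooth_on S (g \<circ> f)"
  using Ck_on_compose unfolding smooth_on_def by blast

lemma smooth_on_cong:
  "open S \<Longrightarrow> (\<And>x. x \<in> S \<Longrightarrow> f x = g x) \<Longrightarrow> smooth_on S f \<Longrightarrow> smooth_on S g"
  using Ck_on_cong unfolding smooth_on_def by blast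

lemma smooth_on_subset: "smooth_on S f \<Longrightarrow> T \<subseteq> S \<Longrightarrow> smooth_on T f"
  using Ck_on_subset unfolding smooth_on_def by blast

lemma smooth_on_const: "smooth_on S (\<lambda>x. c)"
  using Ck_on_const unfolding smooth_on_def by blast

lemma smooth_on_differentiable: "smooth_on S f \<Longrightarrow> x \<in> S \<Longrightarrow> f differentiable (at x)"
  unfolding smooth_on_def by (auto dest!: spec[of _ "Suc 0"])

lemma smooth_on_frechet_derivative:
  "smooth_on S f \<Longrightarrow> smooth_on S (\<lambda>x. frechet_derivative f (at x) v)"
  unfolding smooth_on_def using Ck_on.simps(2) by blast


section \<open>Coordinate fields\<close>

lemma chart_at_mem:
  assumes "smooth_atlas A"
  shows "chart_at A p \<in> A" "p \<in> fst (chart_at A p)"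
proof -
  have "p \<in> (\<Union>c\<in>A. fst c)"
    using assms unfolding smooth_atlas_def by simp
  then have "\<exists>c. c \<in> A \<and> p \<in> fst c"
    by blast
  then show "chart_at A p \<in> A" "p \<in> fst (chart_at A p)"
    unfolding chart_at_def by (metis (mono_tags, lifting) someI_ex)+
qed

lemma atlas_open_domain: "smooth_atlas A \<Longrightarrow> c \<in> A \<Longrightarrow> open (fst c)"
  unfolding smooth_atlas_def by blast

lemma chart_inv_left:
  assumes "smooth_atlas A" "c \<in> A" "q \<in> fst c"
  shows "chart_inv c (snd c q) = q"
proof -
  have "homeomorphism (fst c) (snd c ` fst c) (snd c) (chart_inv c)"
    using assms unfolding smooth_atlas_def by blast
  then show ?thesis
    using assms(3) homeomorphism_apply1 by metis
qed

lemma open_chart_image: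
  assumes "smooth_atlas A" "c \<in> A" "open U" "U \<subseteq> fst c"
  shows "open (snd c ` U)"
proof -
  have "homeomorphism (fst c) (snd c ` fst c) (snd c) (chart_inv c)" "open (snd c ` fst c)"
    using assms unfolding smooth_atlas_def by blast+
  then show ?thesis
    by (meson assms(3,4) homeomorphism_imp_open_map open_subset openin_open_trans)
qed

lemma transition_smooth:
  "smooth_atlas A \<Longrightarrow> c \<in> A \<Longrightarrow> c' \<in> A \<Longrightarrow>
    smooth_on (snd c ` (fst c \<inter> fst c')) (snd c' \<circ> chart_inv c)"
  unfolding smooth_atlas_def by blast

lemma transition_differentiable:
  assumes "smooth_atlas A" "c \<in> A" "c' \<in> A" "q \<in> fst c" "q \<in> fst c'"
  shows "(snd c' \<circ> chart_inv c) differentiable (at (snd c q))"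
  using smooth_on_differentiable[OF transition_smooth[OF assms(1-3)]] assms(4,5) by blast

text \<open>\<open>tvec\<close> differentiates the transition from \<open>c\<close> to the preferred
  chart of \<open>q\<close>, and \<open>tcoord\<close> the one from there to \<open>c'\<close>. The
  chain rule cancels the preferred chart, which may jump with \<open>q\<close>, leaving an
  expression that is smooth in \<open>q\<close>.\<close>

lemma tcoord_tvec:
  assumes A: "smooth_atlas A" and c: "c \<in> A" "c' \<in> A" and q: "q \<in> fst c" "q \<in> fst c'"
  shows "tcoord A c' q (tvec A c q a) = frechet_derivative (snd c' \<circ> chart_inv c) (at (snd c q)) a"
proof -
  let ?d = "chart_at A q"
  let ?S = "snd c ` (fst c \<inter> (fst ?d \<inter> fst c'))"
  note d = chart_at_mem[OF A, of q]
  have "open ?S"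
    using A c d by (intro open_chart_image) (auto intro: atlas_open_domain)
  have "((snd c' \<circ> chart_inv ?d) \<circ> (snd ?d \<circ> chart_inv c) has_derivative
      frechet_derivative (snd c' \<circ> chart_inv ?d) (at (snd ?d q)) \<circ>
      frechet_derivative (snd ?d \<circ> chart_inv c) (at (snd c q))) (at (snd c q))"
    using transition_differentiable[OF A] c q d
    by (intro diff_chain_at) (simp_all add: chart_inv_left[OF A] frechet_derivative_works[symmetric])
  then have "frechet_derivative ((snd c' \<circ> chart_inv ?d) \<circ> (snd ?d \<circ> chart_inv c)) (at (snd c q)) =
      frechet_derivative (snd c' \<circ> chart_inv ?d) (at (snd ?d q)) \<circ>
      frechet_derivative (snd ?d \<circ> chart_inv c) (at (snd c q))"
    using frechet_derivative_at by metis
  \<comment> \<open>The detour through \<open>?d\<close> equals the direct transition only over the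
    triple overlap of chart domains, whose image \<open>?S\<close> is an open neighbourhood of
    \<open>snd c q\<close>.\<close>
  moreover have "frechet_derivative ((snd c' \<circ> chart_inv ?d) \<circ> (snd ?d \<circ> chart_inv c)) (at (snd c q)) =
      frechet_derivative (snd c' \<circ> chart_inv c) (at (snd c q))"
    using \<open>open ?S\<close> q d c
    by (intro frechet_derivative_cong_open[of ?S]) (auto simp: chart_inv_left[OF A])
  ultimately show ?thesis
    unfolding tcoord_def dir_deriv_def tvec_def by (metis comp_apply)
qed

lemma tcoord_tvec_same:
  assumes A: "smooth_atlas A" and c: "c \<in> A" "q \<in> fst c"
  shows "tcoord A c q (tvec A c q a) = a"
proof -
  have "frechet_derivative (snd c \<circ> chart_inv c) (at (snd c q)) = frechet_derivative (\<lambda>u. u) (at (snd c q))"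
    using A c by (intro frechet_derivative_cong_open[OF open_chart_image[of A c "fst c"]])
      (auto simp: chart_inv_left[OF A] atlas_open_domain)
  then show ?thesis
    using tcoord_tvec[OF A c(1,1) c(2,2)] by simp
qed

lemma tvec_scaleR:
  assumes A: "smooth_atlas A" and c: "c \<in> A" "q \<in> fst c"
  shows "tvec A c q (r *\<^sub>R a) = r *\<^sub>R tvec A c q a"
  unfolding tvec_def
  by (intro linear_scale linear_frechet_derivative transition_differentiable[OF A] c chart_at_mem[OF A])

lemma coord_field_scaleR:
  assumes "smooth_atlas A" "c \<in> A"
  shows "coord_field A c (r *\<^sub>R a) q = r *\<^sub>R coord_field A c a q"
  by (simp add: coord_field_def tvec_scaleR[OF assms])

text \<open>Let \<open>c1\<close> be the chart giving the components and \<open>c2\<close> the one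
  in which smoothness is tested. By \<open>tcoord_tvec\<close> the components are the derivative in
  direction \<open>a\<close> of the transition from \<open>c\<close> to \<open>c1\<close>, composed
  with the transition from \<open>c2\<close> to \<open>c\<close>.\<close>

lemma smooth_coord_field:
  assumes A: "smooth_atlas A" and c: "c \<in> A"
  shows "smooth_field A (fst c) (coord_field A c a)"
  unfolding smooth_field_def smooth_fun_def
proof (intro ballI)
  fix c1 c2
  assume c1: "c1 \<in> A" and c2: "c2 \<in> A"
  let ?S = "snd c2 ` (fst c2 \<inter> (fst c \<inter> fst c1))"
  let ?D = "\<lambda>u. frechet_derivative (snd c1 \<circ> chart_inv c) (at u) a"
  have S: "open ?S"
    using A c c1 c2 by (intro open_chart_image) (auto intro: atlas_open_domain)
  have "smooth_on ?S (?D \<circ> (snd c \<circ> chart_inv c2))"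
  proof (rule smooth_on_compose[OF S])
    show "smooth_on ?S (snd c \<circ> chart_inv c2)"
      by (rule smooth_on_subset[OF transition_smooth[OF A c2 c]]) auto
    show "smooth_on (snd c ` (fst c \<inter> fst c1)) ?D"
      by (intro smooth_on_frechet_derivative transition_smooth[OF A c c1])
    show "(snd c \<circ> chart_inv c2) ` ?S \<subseteq> snd c ` (fst c \<inter> fst c1)"
      using c2 by (auto simp: chart_inv_left[OF A])
  qed
  then show "smooth_on ?S ((\<lambda>q. tcoord A c1 q (coord_field A c a q)) \<circ> chart_inv c2)"
    by (rule smooth_on_cong[OF S, rotated])
      (use c c1 c2 in \<open>auto simp: chart_inv_left[OF A] coord_field_def tcoord_tvec[OF A]\<close>)
qed

text \<open>The bracket at \<open>p\<close> differentiates components in the preferred chart of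
  \<open>p\<close>; for coordinate fields of that very chart they are constant nearby.\<close>

lemma lie_bracket_coord_field:
  assumes A: "smooth_atlas A"
  shows "lie_bracket A (coord_field A (chart_at A p) a) (coord_field A (chart_at A p) b) p = 0"
proof -
  let ?c = "chart_at A p"
  note c = chart_at_mem[OF A, of p]
  have "dir_deriv A (\<lambda>q. tcoord A ?c q (coord_field A ?c a q)) p x = 0" for a x
  proof -
    have "frechet_derivative ((\<lambda>q. tcoord A ?c q (coord_field A ?c a q)) \<circ> chart_inv ?c) (at (snd ?c p)) =
        frechet_derivative (\<lambda>u. a) (at (snd ?c p))"
      using c A
      by (intro frechet_derivative_cong_open[OF open_chart_image[of A ?c "fst ?c"]])
        (auto simp: chart_inv_left[OF A] atlas_open_domain coord_field_def tcoord_tvec_same[OF A])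
    then show ?thesis
      unfolding dir_deriv_def by simp
  qed
  then show ?thesis
    unfolding lie_bracket_def by simp
qed


section \<open>Connections and curvature\<close>

text \<open>Fixes \<open>U\<close> and \<open>Y\<close> and leaves the conjunction of five clauses,
  from which the lemmas below select by position.\<close>

lemmas affine_connectionD =
  affine_connection_def[THEN iffD1, THEN spec, THEN spec, THEN mp, OF _ conjI]

lemma affine_connection_linear:
  assumes "affine_connection B nabla" "open U" "smooth_field B U Y" "p \<in> U"
  shows "linear (\<lambda>x. nabla p x Y)"
  using affine_connectionD[OF assms(1-3), THEN conjunct1, THEN bspec, OF assms(4)] .

lemma affine_connection_cong:
  assumes "affine_connection B nabla" "open U" "smooth_field B U Y" "p \<in> U"
    and "\<And>q. q \<in> U \<Longrightarrow> Z q = Y q"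
  shows "nabla p x Z = nabla p x Y"
  using affine_connectionD[OF assms(1-3), THEN conjunct2, THEN conjunct1, THEN spec, THEN mp]
    assms(4,5) by blast

text \<open>The Leibniz rule for a constant function, whose derivative vanishes.\<close>

lemma affine_connection_scaleR:
  assumes "affine_connection B nabla" "open U" "smooth_field B U Y" "p \<in> U"
  shows "nabla p x (\<lambda>q. r *\<^sub>R Y q) = r *\<^sub>R nabla p x Y"
proof -
  have "smooth_fun B U (\<lambda>q. r)"
    unfolding smooth_fun_def comp_def by (intro ballI smooth_on_const)
  then have "nabla p x (\<lambda>q. r *\<^sub>R Y q) = dir_deriv B (\<lambda>q. r) p x *\<^sub>R Y p + r *\<^sub>R nabla p x Y"
    using affine_connectionD[OF assms(1-3), THEN conjunct2, THEN conjunct2, THEN conjunct2, THEN conjunct1, THEN spec, THEN mp] assms(4) by simp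
  moreover have "dir_deriv B (\<lambda>q. r) p x = 0"
    by (simp add: dir_deriv_def comp_def)
  ultimately show ?thesis
    by simp
qed

lemma affine_connection_smooth:
  assumes "affine_connection B nabla" "open U" "smooth_field B U Y" "smooth_field B U X"
  shows "smooth_field B U (\<lambda>q. nabla q (X q) Y)"
  using affine_connectionD[OF assms(1-3), THEN conjunct2, THEN conjunct2, THEN conjunct2, THEN conjunct2, THEN spec, THEN mp, OF assms(4)] .

text \<open>With \<open>?X\<close> the coordinate field extending \<open>v\<close>, the two
  arguments extend to \<open>r\<close> and \<open>s\<close> times \<open>?X\<close>. Both
  second-derivative terms then equal \<open>r * s\<close> times the derivative of \<open>?W\<close>
  along \<open>?X\<close> and cancel, and the bracket term is zero because coordinate fields
  commute.\<close>

lemma curvature_tensor_collinear: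
  assumes B: "smooth_atlas B" and conn: "affine_connection B nabla"
  shows "curvature_tensor B nabla p (r *\<^sub>R v) (s *\<^sub>R v) z = 0"
proof -
  define c where "c = chart_at B p"
  let ?U = "fst c" and ?X = "coord_field B c v" and ?Z = "coord_field B c z"
  let ?W = "\<lambda>q. nabla q (?X q) ?Z"
  have c: "c \<in> B" "p \<in> ?U"
    using chart_at_mem[OF B] by (simp_all add: c_def)
  note U = atlas_open_domain[OF B c(1)]
  note smooth = smooth_coord_field[OF B c(1)]
  have W: "smooth_field B ?U ?W"
    by (rule affine_connection_smooth[OF conn U smooth smooth])
  have scale: "nabla q (t *\<^sub>R x) Y = t *\<^sub>R nabla q x Y"
    if "smooth_field B ?U Y" "q \<in> ?U" for t q x Y
    using linear_scale[OF affine_connection_linear[OF conn U that]] .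
  \<comment> \<open>Stated for all \<open>r\<close> and \<open>s\<close> since the curvature uses it
    a second time with the two exchanged.\<close>
  have second: "nabla p (r *\<^sub>R ?X p) (\<lambda>q. nabla q (s *\<^sub>R ?X q) ?Z) = (r * s) *\<^sub>R nabla p (?X p) ?W" for r s
  proof -
    have "nabla p x (\<lambda>q. nabla q (s *\<^sub>R ?X q) ?Z) = s *\<^sub>R nabla p x ?W" for x
    proof -
      let ?Y = "\<lambda>q. nabla q (s *\<^sub>R ?X q) ?Z"
      \<comment> \<open>\<open>?Y\<close> and \<open>s\<close> times \<open>?W\<close> are known to
        agree on \<open>?U\<close> only, so the locality clause is applied, and this requires
        \<open>?Y\<close> to be smooth there. Smoothness follows by reading \<open>s\<close> times
        \<open>?X\<close> as the coordinate field of \<open>s *\<^sub>R v\<close>.\<close>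
      have "smooth_field B ?U (\<lambda>q. nabla q (coord_field B c (s *\<^sub>R v) q) ?Z)"
        by (rule affine_connection_smooth[OF conn U smooth smooth])
      then have "smooth_field B ?U ?Y"
        by (simp add: coord_field_scaleR[OF B c(1)])
      then have "nabla p x (\<lambda>q. s *\<^sub>R ?W q) = nabla p x ?Y"
        by (rule affine_connection_cong[OF conn U _ c(2)]) (simp add: scale smooth)
      then show ?thesis
        using affine_connection_scaleR[OF conn U W c(2)] by metis
    qed
    then show ?thesis
      by (simp add: scale[OF W c(2)] mult.commute)
  qed
  \<comment> \<open>This disposes of the bracket term of the curvature, where the direction is the
    zero bracket.\<close>
  have "nabla p 0 ?Z = 0"
    using linear_0[OF affine_connection_linear[OF conn U smooth c(2)]] .
  moreover have "lie_bracket B (coord_field B c (r *\<^sub>R v)) (coord_field B c (s *\<^sub>R v)) p = 0"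
    using lie_bracket_coord_field[OF B] by (simp add: c_def)
  ultimately show ?thesis
    unfolding curvature_tensor_def curvature_def extend_vec_def c_def[symmetric]
    by (simp add: coord_field_scaleR[OF B c(1)] second mult.commute)
qed


section \<open>The index form\<close>

lemma riemannian_metric_nonneg:
  assumes "riemannian_metric B h"
  shows "h p x x \<ge> 0"
proof (cases "x = 0")
  case True
  have "bilinear (h p)"
    using assms unfolding riemannian_metric_def by blast
  then show ?thesis
    using True by (simp add: bilinear_lzero)
next
  case False
  then show ?thesis
    using assms unfolding riemannian_metric_def by (meson less_imp_le)
qed

text \<open>Strict Cauchy-Schwarz: the squared length of a multiple of the part of \<open>y\<close>
  orthogonal to \<open>x\<close> is \<open>h p x x\<close> times the determinant.\<close>

lemma gram_determinant_pos:
  assumes h: "riemannian_metric B h" and xy: "x \<noteq> y" "independent {x, y}"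
  shows "h p x x * h p y y - (h p x y)\<^sup>2 > 0"
proof -
  have bl: "bilinear (h p)" and sym: "h p y x = h p x y" and pos: "\<And>z. z \<noteq> 0 \<Longrightarrow> h p z z > 0"
    using h unfolding riemannian_metric_def by blast+
  \<comment> \<open>The component of \<open>y\<close> orthogonal to \<open>x\<close>, multiplied by
    \<open>h p x x\<close> to avoid a division.\<close>
  define z where "z = h p x x *\<^sub>R y - h p x y *\<^sub>R x"
  have "x \<noteq> 0"
    using xy(2) dependent_zero by blast
  then have xx: "h p x x > 0"
    by (rule pos)
  have "z \<noteq> 0"
  proof
    assume "z = 0"
    then have "h p x x *\<^sub>R y = h p x y *\<^sub>R x"
      by (simp add: z_def)
    then have "y = (h p x y / h p x x) *\<^sub>R x"
      using xx by (simp add: eq_vector_fraction_iff)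
    then have "y \<in> span {x}"
      by (metis span_base span_scale singletonI)
    then show False
      using xy independent_insert[of y "{x}"] by (simp add: insert_commute)
  qed
  then have "h p z z > 0"
    by (rule pos)
  also have "h p z z = h p x x * (h p x x * h p y y - (h p x y)\<^sup>2)"
    by (simp add: z_def bilinear_lsub[OF bl] bilinear_rsub[OF bl] bilinear_lmul[OF bl]
        bilinear_rmul[OF bl] sym power2_eq_square algebra_simps)
  finally show ?thesis
    using xx by (simp add: zero_less_mult_iff)
qed

text \<open>The case \<open>x = y\<close> is listed separately because \<open>{x, y}\<close> is then
  a singleton and may be independent. A common vector \<open>v\<close> treats equal vectors, a zero
  vector and proper multiples alike.\<close>

lemma dependent_pair_collinear:
  fixes x y :: "'k::real_vector"
  assumes "x = y \<or> dependent {x, y}"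
  obtains v r s where "x = r *\<^sub>R v" "y = s *\<^sub>R v"
proof (cases "x = y")
  case True
  then show ?thesis
    using that scaleR_one by metis
next
  case False
  then have dep: "dependent {x, y}"
    using assms by blast
  \<comment> \<open>Otherwise \<open>{y}\<close> would be independent and would remain so after
    inserting \<open>x\<close>.\<close>
  have "y = 0 \<or> x \<in> span {y}"
  proof (rule ccontr)
    assume "\<not> (y = 0 \<or> x \<in> span {y})"
    then have "y \<notin> span {}" "x \<notin> span {y}"
      by simp_all
    then have "independent {x, y}"
      by (intro independent_insertI independent_empty)
    with dep show False
      by (rule notE[rotated])
  qed
  then show ?thesis
  proof
    assume "y = 0"
    then show ?thesis
      using that scaleR_one scaleR_zero_left by metis
  next
    assume "x \<in> span {y}"
    then obtain r where "x = r *\<^sub>R y"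
      unfolding span_singleton by blast
    then show ?thesis
      using that scaleR_one by metis
  qed
qed

text \<open>The curvature hypothesis bounds a quotient, and for independent pairs only. There the
  denominator is positive, so the numerator has the sign of the quotient; for collinear pairs the
  numerator is zero.\<close>

lemma curvature_term_nonpos:
  assumes B: "smooth_atlas B" and h: "riemannian_metric B h" and conn: "affine_connection B nabla"
    and sec: "nonpositive_sectional_curvature B h nabla"
  shows "h p (curvature_tensor B nabla p x y y) x \<le> 0"
proof (cases "x \<noteq> y \<and> independent {x, y}")
  case True
  then have "sectional_curvature B h nabla p x y \<le> 0"
    using sec unfolding nonpositive_sectional_curvature_def by blast
  moreover have "h p x x * h p y y - (h p x y)\<^sup>2 > 0"
    using True gram_determinant_pos[OF h] by blast
  ultimately show ?thesis
    unfolding sectional_curvature_def by (simp add: divide_le_0_iff)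
next
  case False
  then obtain v r s where "x = r *\<^sub>R v" "y = s *\<^sub>R v"
    using dependent_pair_collinear by metis
  then have "curvature_tensor B nabla p x y y = 0"
    using curvature_tensor_collinear[OF B conn] by metis
  moreover have "bilinear (h p)"
    using h unfolding riemannian_metric_def by blast
  ultimately show ?thesis
    by (simp add: bilinear_lzero)
qed

theorem proposition3p2:
  fixes AM :: "('a::{t2_space,second_countable_topology}, real^'n) atlas"
    and g :: "'a \<Rightarrow> real^'n \<Rightarrow> real^'n \<Rightarrow> real"
    and H :: "'a \<Rightarrow> (real^'n) set"
    and AN :: "('b::{t2_space,second_countable_topology}, real^'k) atlas"
    and h :: "'b \<Rightarrow> real^'k \<Rightarrow> real^'k \<Rightarrow> real"
    and nabla :: "('b, real^'k) connection"
    and G :: "'b \<Rightarrow> real"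
    and f :: "'a \<Rightarrow> 'b"
    and m d :: nat
  assumes "smooth_atlas AM" and "riemannian_metric AM g"
    and "compact (UNIV :: 'a set)" and "connected (UNIV :: 'a set)"
    and "CARD('n) = m + d" and "subbundle AM m H"
    and "smooth_atlas AN" and "riemannian_metric AN h" and "levi_civita AN h nabla"
    and "smooth_fun AN UNIV G"
    and "subelliptic_harmonic AM g m H AN h G f"
    and "nonpositive_sectional_curvature AN h nabla"
    and "\<forall>q v. hessian AN nabla G q v v \<le> 0"
  shows "stable_map AM g m H AN h nabla G f"
  unfolding stable_map_def index_form_def Let_def
proof (intro allI impI Bochner_Integration.integral_nonneg)
  \<comment> \<open>The Bochner integral of a nonintegrable function is 0 by default, so
    nonnegativity of the integrand at every \<open>p\<close> is enough.\<close>
  fix V :: "'a \<Rightarrow> real^'k" and p :: 'a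
  have "affine_connection AN nabla"
    using \<open>levi_civita AN h nabla\<close> unfolding levi_civita_def by blast
  note curv = curvature_term_nonpos[OF \<open>smooth_atlas AN\<close> \<open>riemannian_metric AN h\<close> this
      \<open>nonpositive_sectional_curvature AN h nabla\<close>]
  note metric = riemannian_metric_nonneg[OF \<open>riemannian_metric AN h\<close>]
  let ?e = "horizontal_frame g m H p"
  let ?D = "\<lambda>i. pullback_connection AM AN nabla f p (?e i) V"
  let ?w = "\<lambda>i. differential AM AN f p (?e i)"
  have "0 \<le> (\<Sum>i<m. h (f p) (?D i) (?D i) -
      h (f p) (curvature_tensor AN nabla (f p) (?w i) (V p) (V p)) (?w i))"
  \<comment> \<open>Each summand is a squared length minus a nonpositive curvature term, whichever
    vector \<open>?e i\<close> the choice of frame yields.\<close>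
  proof (rule sum_nonneg)
    show "0 \<le> h (f p) (?D i) (?D i) -
        h (f p) (curvature_tensor AN nabla (f p) (?w i) (V p) (V p)) (?w i)" for i
      using curv[of "f p" "?w i" "V p"] metric[of "f p" "?D i"] by linarith
  qed
  moreover have "hessian AN nabla G (f p) (V p) (V p) \<le> 0"
    using assms(13) by blast
  ultimately show "0 \<le> (\<Sum>i<m. h (f p) (?D i) (?D i) -
      h (f p) (curvature_tensor AN nabla (f p) (?w i) (V p) (V p)) (?w i)) -
      hessian AN nabla G (f p) (V p) (V p)"
    by simp
qed

end
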